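(* Let $\mathcal{A}$ be a nonnegative combinatorially symmetric irreducible tensor of order $m$ and dimension $n$. Then $\mathcal{A}$ has only one eigenvector corresponding to $\rho(\mathcal{A})$ up to a scalar, namely the Perron vector; equivalently, $s(\mathcal{A})=1$.
   Context: Let $m\ge 2$, $n\ge 1$, $[n]=\{1,\dots,n\}$. A tensor of order $m$ and dimension $n$ is an array $\mathcal{A}=(a_{i_1i_2\ldots i_m})$ of complex numbers indexed by $i_1,\dots,i_m\in[n]$; it is nonnegative if all its entries are nonnegative reals. For $\mathbf{x}\in\mathbb{C}^n$, $\mathcal{A}\mathbf{x}^{m-1}\in\mathbb{C}^n$ is defined by $(\mathcal{A}\mathbf{x}^{m-1})_i=\sum_{i_2,\dots,i_m\in[n]}a_{ii_2\cdots i_m}x_{i_2}\cdots x_{i_m}$, and $\mathbf{x}^{[m-1]}=(x_1^{m-1},\dots,x_n^{m-1})$. A number $\lambda\in\mathbb{C}$ is an eigenvalue of $\mathcal{A}$ if $\mathcal{A}\mathbf{x}^{m-1}=\lambda\mathbf{x}^{[m-1]}$ for some nonzero $\mathbf{x}\in\mathbb{C}^n$, which is called an eigenvector corresponding to $\lambda$ (eigenvectors and scalars are complex). The spectral radius $\rho(\mathcal{A})$ is the largest modulus of an eigenvalue of $\mathcal{A}$. $\mathcal{A}$ is reducible if there is a nonempty proper subset $I\subset[n]$ such that $a_{i_1i_2\ldots i_m}=0$ for all $i_1\in I$ and all $i_2,\dots,i_m\notin I$; otherwise it is irreducible. $\mathcal{A}$ is combinatorially symmetric if whether $a_{i_1\ldots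 i_m}\neq 0$ is invariant under all permutations of the indices. For a nonnegative irreducible tensor, $\rho(\mathcal{A})$ is an eigenvalue with a positive eigenvector, unique up to a positive scalar, called the Perron vector. For an invertible diagonal $n\times n$ complex matrix $D=\mathrm{diag}(d_{11},\dots,d_{nn})$, the tensor $D^{-(m-1)}\mathcal{A}D$ has entries $d_{i_1i_1}^{-(m-1)}a_{i_1i_2\ldots i_m}d_{i_2i_2}\cdots d_{i_mi_m}$. The stabilizing index $s(\mathcal{A})$ is the cardinality of $\mathfrak{D}^{(0)}(\mathcal{A})=\{D: \mathcal{A}=D^{-(m-1)}\mathcal{A}D,\ d_{11}=1\}$, where $D$ ranges over invertible diagonal $n\times n$ complex matrices. *)

theory Defs
  imports
    "Jordan_Normal_Form.Matrix"
    "HOL-Combinatorics.Permutations"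
    "HOL-Library.Nonpos_Ints"
    Complex_Main
begin

text \<open>
  A tensor of order \<open>m\<close> and dimension \<open>n\<close> is a function from index lists to the complex numbers,
  of which only the values on \<open>tensor_indices m n\<close> matter.  As is usual for the
  vectors and matrices used here, indices start from \<open>0\<close>, so \<open>[n]\<close> is represented by \<open>{0..<n}\<close>
  and the first index is \<open>0\<close>.
\<close>

type_synonym tensor = "nat list \<Rightarrow> complex"

definition tensor_indices :: "nat \<Rightarrow> nat \<Rightarrow> nat list set" where
  "tensor_indices k n = {js. length js = k \<and> set js \<subseteq> {0..<n}}"

definition nonneg_tensor :: "nat \<Rightarrow> nat \<Rightarrow> tensor \<Rightarrow> bool" where
  "nonneg_tensor m n A \<longleftrightarrow> (\<forall>js\<in>tensor_indices m n. A js \<in> \<real>\<^sub>\<ge>\<^sub>0)"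

definition tensor_apply :: "nat \<Rightarrow> nat \<Rightarrow> tensor \<Rightarrow> complex vec \<Rightarrow> complex vec" where
  "tensor_apply m n A x =
     vec n (\<lambda>i. \<Sum>js\<in>tensor_indices (m - 1) n. A (i # js) * prod_list (map (\<lambda>j. x $ j) js))"

definition vec_hpower :: "complex vec \<Rightarrow> nat \<Rightarrow> complex vec" where
  "vec_hpower x k = map_vec (\<lambda>z. z ^ k) x"

definition tensor_eigenvector :: "nat \<Rightarrow> nat \<Rightarrow> tensor \<Rightarrow> complex \<Rightarrow> complex vec \<Rightarrow> bool" where
  "tensor_eigenvector m n A l x \<longleftrightarrow>
     x \<in> carrier_vec n \<and> x \<noteq> 0\<^sub>v n \<and> tensor_apply m n A x = l \<cdot>\<^sub>v vec_hpower x (m - 1)"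

definition tensor_eigenvalue :: "nat \<Rightarrow> nat \<Rightarrow> tensor \<Rightarrow> complex \<Rightarrow> bool" where
  "tensor_eigenvalue m n A l \<longleftrightarrow> (\<exists>x. tensor_eigenvector m n A l x)"

text \<open>
  \<open>GREATEST\<close> rather than \<open>Max\<close>: the largest modulus, without presupposing that
  there are only finitely many eigenvalues.
\<close>

definition tensor_spectral_radius :: "nat \<Rightarrow> nat \<Rightarrow> tensor \<Rightarrow> real" where
  "tensor_spectral_radius m n A = (GREATEST r. \<exists>l. tensor_eigenvalue m n A l \<and> r = cmod l)"

definition reducible_tensor :: "nat \<Rightarrow> nat \<Rightarrow> tensor \<Rightarrow> bool" where
  "reducible_tensor m n A \<longleftrightarrow>
     (\<exists>I. I \<noteq> {} \<and> I \<subset> {0..<n} \<and>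
        (\<forall>i\<in>I. \<forall>js\<in>tensor_indices (m - 1) n. set js \<inter> I = {} \<longrightarrow> A (i # js) = 0))"

abbreviation irreducible_tensor :: "nat \<Rightarrow> nat \<Rightarrow> tensor \<Rightarrow> bool" where
  "irreducible_tensor m n A \<equiv> \<not> reducible_tensor m n A"

definition combinatorially_symmetric :: "nat \<Rightarrow> nat \<Rightarrow> tensor \<Rightarrow> bool" where
  "combinatorially_symmetric m n A \<longleftrightarrow>
     (\<forall>js\<in>tensor_indices m n. \<forall>\<pi>. \<pi> permutes {..<m} \<longrightarrow>
        (A (permute_list \<pi> js) \<noteq> 0 \<longleftrightarrow> A js \<noteq> 0))"

definition perron_vector :: "nat \<Rightarrow> nat \<Rightarrow> tensor \<Rightarrow> complex vec \<Rightarrow> bool" where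
  "perron_vector m n A x \<longleftrightarrow>
     tensor_eigenvector m n A (complex_of_real (tensor_spectral_radius m n A)) x \<and>
     (\<forall>i<n. x $ i \<in> \<real> \<and> Re (x $ i) > 0)"

text \<open>The tensor \<open>D\<^bsup>-(m-1)\<^esup> A D\<close>.\<close>

definition diagonal_scaling :: "nat \<Rightarrow> complex mat \<Rightarrow> tensor \<Rightarrow> tensor" where
  "diagonal_scaling m D A = (\<lambda>js. inverse (D $$ (hd js, hd js) ^ (m - 1)) * A js *
     prod_list (map (\<lambda>j. D $$ (j, j)) (tl js)))"

definition stabilizer :: "nat \<Rightarrow> nat \<Rightarrow> tensor \<Rightarrow> complex mat set" where
  "stabilizer m n A =
     {D \<in> carrier_mat n n. diagonal_mat D \<and> invertible_mat D \<and>
        (\<forall>js\<in>tensor_indices m n. A js = diagonal_scaling m D A js) \<and> D $$ (0, 0) = 1}"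

definition stabilizing_index :: "nat \<Rightarrow> nat \<Rightarrow> tensor \<Rightarrow> nat" where
  "stabilizing_index m n A = card (stabilizer m n A)"

end

theory Submission
  imports Defs "HOL-Analysis.Function_Topology"
begin

text \<open>
  Write \<open>k = m - 1\<close>.  Irreducibility says that for every nonempty proper set \<open>I\<close> of indices some
  nonzero entry has its first index in \<open>I\<close> and all others outside \<open>I\<close>.

  Rigidity.  Let \<open>f\<close> be a function on the indices with \<open>f j\<^sub>1 \<cdots> f j\<^sub>k = (f i)\<^sup>k\<close> for each
  nonzero entry \<open>(i, j\<^sub>1, \<dots>, j\<^sub>k)\<close>.  If the set \<open>E\<close> on which \<open>f\<close> takes a nonzero value \<open>z\<close> were
  nonempty and proper, irreducibility would give a nonzero entry \<open>(l, j, \<dots>)\<close> with \<open>l\<close> outside \<open>E\<close> and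
  all other indices inside.  By combinatorial symmetry the entry with \<open>l\<close> and \<open>j\<close> exchanged is nonzero
  too, and its equation \<open>f l \<cdot> z\<^bsup>k-1\<^esup> = z\<^sup>k\<close> forces \<open>f l = z\<close>.  Hence \<open>f\<close> is constant; this is
  \<open>constant_if_balanced\<close>, which asks for the equation only at those \<open>i\<close> where \<open>f\<close> takes the value
  \<open>z\<close>.  The diagonal of an element of the stabilizer is such an \<open>f\<close> with \<open>z = 1\<close>, so the stabilizer
  is trivial (\<open>stabilizer_eq_one\<close>).

  Eigenvectors.  Let \<open>p\<close> be a positive eigenvector for some \<open>r \<ge> 0\<close>.  Evaluating the equation of any
  eigenvector \<open>v\<close> at an index where \<open>\<bar>v\<^sub>i\<bar> / p\<^sub>i\<close> is largest bounds the modulus of its eigenvalue by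
  \<open>r\<close> (\<open>eigenvalue_le_perron_value\<close>), so \<open>r\<close> is the spectral radius.  If the eigenvalue is \<open>r\<close> itself,
  the triangle inequality is an equality at such an index, and this is exactly the equation above for
  \<open>f = v / p\<close>.  So \<open>v\<close> is a multiple of \<open>p\<close> (\<open>perron_eigenvector_unique\<close>).

  Existence of \<open>p\<close> (\<open>perron_pair_exists\<close>) is the Collatz--Wielandt argument.  By compactness there is
  a largest \<open>t\<close> for which \<open>A x\<^sup>k \<ge> t x\<^bsup>[k]\<^esup>\<close> has a nonzero solution \<open>x \<ge> 0\<close>.  If the inequality were
  strict exactly on a nonempty set \<open>K\<close>, then raising \<open>x\<close> slightly on \<open>K\<close> keeps it strict there and, by
  irreducibility, makes it strict at a further index; once it is strict everywhere \<open>t\<close> can be raised.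
  So every maximal solution is an eigenvector, and irreducibility rules out zero components.
\<close>



section \<open>The homogeneous form of an array\<close>

text \<open>
  This is the component of \<open>tensor_apply\<close> over an arbitrary semiring, with a vector given by a
  function on the indices: the Perron pair is built over the reals, where order is available, and then
  compared with complex eigenvectors.
\<close>

definition tensor_form :: "nat \<Rightarrow> nat \<Rightarrow> (nat list \<Rightarrow> 'a::comm_semiring_1) \<Rightarrow> (nat \<Rightarrow> 'a) \<Rightarrow> nat \<Rightarrow> 'a"
  where "tensor_form k n a x i = (\<Sum>js\<in>tensor_indices k n. a (i # js) * prod_list (map x js))"

lemma finite_tensor_indices: "finite (tensor_indices k n)"
proof -
  have "tensor_indices k n = {js. set js \<subseteq> {0..<n} \<and> length js = k}"
    by (auto simp: tensor_indices_def)
  then show ?thesis by (simp add: finite_lists_length_eq)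
qed

lemma Cons_in_tensor_indices:
  "i # js \<in> tensor_indices (Suc k) n \<longleftrightarrow> i < n \<and> js \<in> tensor_indices k n"
  by (auto simp: tensor_indices_def)

lemma prod_list_map_scale:
  fixes c :: "'a::comm_semiring_1"
  shows "prod_list (map (\<lambda>j. c * x j) js) = c ^ length js * prod_list (map x js)"
  by (induction js) (simp_all add: algebra_simps)

lemma prod_list_map_nonneg:
  fixes x :: "nat \<Rightarrow> real"
  assumes "\<And>j. j \<in> set js \<Longrightarrow> 0 \<le> x j"
  shows "0 \<le> prod_list (map x js)"
  using assms by (induction js) auto

lemma prod_list_map_mono:
  fixes x y :: "nat \<Rightarrow> real"
  assumes "\<And>j. j \<in> set js \<Longrightarrow> 0 \<le> x j" "\<And>j. j \<in> set js \<Longrightarrow> x j \<le> y j"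
  shows "prod_list (map x js) \<le> prod_list (map y js)"
  using assms
proof (induction js)
  case (Cons j js)
  moreover have "0 \<le> y j" using Cons.prems(1,2)[of j] by simp
  ultimately show ?case by (auto intro!: mult_mono prod_list_map_nonneg)
qed simp

lemma prod_list_map_pos:
  fixes x :: "nat \<Rightarrow> real"
  assumes "\<And>j. j \<in> set js \<Longrightarrow> 0 < x j"
  shows "0 < prod_list (map x js)"
  using assms by (induction js) auto

lemma prod_list_map_strict_mono:
  fixes x y :: "nat \<Rightarrow> real"
  assumes "js \<noteq> []" "\<And>j. j \<in> set js \<Longrightarrow> 0 \<le> x j" "\<And>j. j \<in> set js \<Longrightarrow> x j < y j"
  shows "prod_list (map x js) < prod_list (map y js)"
proof -
  obtain j ks where js: "js = j # ks" using assms(1) by (cases js) auto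
  have "prod_list (map x ks) \<le> prod_list (map y ks)"
    using assms(2,3) by (intro prod_list_map_mono) (auto simp: js intro: less_imp_le)
  moreover have "0 < prod_list (map y ks)"
    using assms(2,3) by (intro prod_list_map_pos) (force simp: js intro: le_less_trans)
  moreover have "0 \<le> x j" "x j < y j" using assms by (auto simp: js)
  ultimately have "x j * prod_list (map x ks) \<le> x j * prod_list (map y ks)"
     "x j * prod_list (map y ks) < y j * prod_list (map y ks)"
    by (auto intro: mult_left_mono)
  then show ?thesis by (simp add: js)
qed

lemma tendsto_tensor_form:
  fixes a :: "nat list \<Rightarrow> real"
  assumes "\<And>j. ((\<lambda>e. f e j) \<longlongrightarrow> g j) F"
  shows "((\<lambda>e. tensor_form k n a (f e) i) \<longlongrightarrow> tensor_form k n a g i) F"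
proof -
  have "((\<lambda>e. prod_list (map (f e) js)) \<longlongrightarrow> prod_list (map g js)) F" for js
    by (induction js) (auto intro!: tendsto_mult assms)
  then show ?thesis unfolding tensor_form_def by (intro tendsto_intros)
qed

lemma tensor_form_scale:
  "tensor_form k n a (\<lambda>j. c * x j) i = c ^ k * tensor_form k n a x i"
  unfolding tensor_form_def sum_distrib_left
  by (rule sum.cong) (auto simp: prod_list_map_scale tensor_indices_def algebra_simps)

definition nonneg_array :: "nat \<Rightarrow> nat \<Rightarrow> (nat list \<Rightarrow> real) \<Rightarrow> bool" where
  "nonneg_array k n a \<longleftrightarrow> (\<forall>i<n. \<forall>js\<in>tensor_indices k n. 0 \<le> a (i # js))"

lemma tensor_form_mono:
  assumes "nonneg_array k n a" "i < n"
    and "\<And>j. j < n \<Longrightarrow> 0 \<le> x j" "\<And>j. j < n \<Longrightarrow> x j \<le> y j"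
  shows "tensor_form k n a x i \<le> tensor_form k n a y i"
  unfolding tensor_form_def
proof (rule sum_mono)
  fix js assume js: "js \<in> tensor_indices k n"
  then have "prod_list (map x js) \<le> prod_list (map y js)"
    using assms(3,4) by (intro prod_list_map_mono) (auto simp: tensor_indices_def)
  then show "a (i # js) * prod_list (map x js) \<le> a (i # js) * prod_list (map y js)"
    using assms(1,2) js by (auto simp: nonneg_array_def intro: mult_left_mono)
qed

lemma tensor_form_strict_mono:
  assumes "nonneg_array k n a" "i < n" "k \<ge> 1"
    and "\<And>j. j < n \<Longrightarrow> 0 \<le> x j" "\<And>j. j < n \<Longrightarrow> x j \<le> y j"
    and ks: "ks \<in> tensor_indices k n" "a (i # ks) \<noteq> 0" "\<And>j. j \<in> set ks \<Longrightarrow> x j < y j"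
  shows "tensor_form k n a x i < tensor_form k n a y i"
  unfolding tensor_form_def
proof (rule sum_strict_mono_ex1[OF finite_tensor_indices])
  show "\<forall>js\<in>tensor_indices k n. a (i # js) * prod_list (map x js) \<le> a (i # js) * prod_list (map y js)"
  proof
    fix js assume js: "js \<in> tensor_indices k n"
    then have "prod_list (map x js) \<le> prod_list (map y js)"
      using assms(4,5) by (intro prod_list_map_mono) (auto simp: tensor_indices_def)
    then show "a (i # js) * prod_list (map x js) \<le> a (i # js) * prod_list (map y js)"
      using assms(1,2) js by (auto simp: nonneg_array_def intro: mult_left_mono)
  qed
  have "0 < a (i # ks)"
    using assms(1,2) ks by (auto simp: nonneg_array_def less_le)
  moreover have "prod_list (map x ks) < prod_list (map y ks)"
    using assms ks by (intro prod_list_map_strict_mono) (auto simp: tensor_indices_def)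
  ultimately show "\<exists>js\<in>tensor_indices k n. a (i # js) * prod_list (map x js) < a (i # js) * prod_list (map y js)"
    using ks(1) by (auto intro!: bexI[of _ ks])
qed

section \<open>The Perron pair\<close>

text \<open>
  The pairs over which the Collatz--Wielandt maximum of \<open>t\<close> is taken.
\<close>

definition subinvariant :: "nat \<Rightarrow> nat \<Rightarrow> (nat list \<Rightarrow> real) \<Rightarrow> (nat \<Rightarrow> real) \<Rightarrow> real \<Rightarrow> bool" where
  "subinvariant k n a x t \<longleftrightarrow> (\<forall>i<n. 0 \<le> x i) \<and> (\<exists>i<n. 0 < x i) \<and> 0 \<le> t \<and>
     (\<forall>i<n. t * x i ^ k \<le> tensor_form k n a x i)"

definition irreducible_array :: "nat \<Rightarrow> nat \<Rightarrow> (nat list \<Rightarrow> 'a::zero) \<Rightarrow> bool" where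
  "irreducible_array k n a \<longleftrightarrow> (\<forall>I. I \<noteq> {} \<and> I \<subset> {0..<n} \<longrightarrow>
     (\<exists>i\<in>I. \<exists>js\<in>tensor_indices k n. set js \<inter> I = {} \<and> a (i # js) \<noteq> 0))"

lemma irreducible_arrayE:
  assumes "irreducible_array k n a" "I \<noteq> {}" "I \<subset> {0..<n}"
  obtains i js where "i \<in> I" "js \<in> tensor_indices k n" "set js \<inter> I = {}" "a (i # js) \<noteq> 0"
proof -
  have "\<exists>i\<in>I. \<exists>js\<in>tensor_indices k n. set js \<inter> I = {} \<and> a (i # js) \<noteq> 0"
    using assms(2,3) by (intro assms(1)[unfolded irreducible_array_def, rule_format] conjI)
  then show ?thesis using that by blast
qed

text \<open>
  Both the condition and \<open>t\<close> are unchanged when \<open>x\<close> is rescaled, so it suffices to consider \<open>x\<close> with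
  largest component \<open>1\<close>.  At that component the condition bounds \<open>t\<close> by a row sum of \<open>a\<close>, and the
  admissible pairs form a compact set.
\<close>

lemma maximal_subinvariant_exists:
  assumes a: "nonneg_array k n a" and n: "n \<ge> 1"
  shows "\<exists>x t. subinvariant k n a x t \<and> (\<forall>y s. subinvariant k n a y s \<longrightarrow> s \<le> t)"
proof -
  define C where "C = Max ((\<lambda>i. tensor_form k n a (\<lambda>_. 1) i) ` {..<n})"
  have C: "tensor_form k n a (\<lambda>_. 1) i \<le> C" if "i < n" for i
    unfolding C_def using that by simp
  \<comment> \<open>Components beyond the dimension are pinned to 0, which makes this a product of compact
    intervals over all natural numbers.\<close>
  define box :: "(nat \<Rightarrow> real) set" where "box = {x. \<forall>i. x i \<in> (if i < n then {0..1} else {0})}"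
  have box: "compact box"
  proof -
    have "compactin (product_topology (\<lambda>i. euclidean) UNIV)
        (PiE UNIV (\<lambda>i. if i < n then {0..1::real} else {0}))"
      by (auto simp: compactin_PiE)
    then show ?thesis
      by (simp add: box_def euclidean_product_topology PiE_def Pi_def)
  qed
  define top :: "(nat \<Rightarrow> real) set" where "top = (\<Union>i<n. {x. x i = 1})"
  define S :: "((nat \<Rightarrow> real) \<times> real) set" where
    "S = (box \<times> {0..C}) \<inter> (top \<times> UNIV) \<inter>
      (\<Inter>i<n. {p. snd p * fst p i ^ k \<le> tensor_form k n a (fst p) i})"
  have cont: "continuous_on UNIV (\<lambda>p::(nat \<Rightarrow> real) \<times> real. fst p i)" for i
    by (rule continuous_on_product_then_coordinatewise) (intro continuous_intros)
  have "compact S"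
    unfolding S_def
  proof (intro compact_Int_closed)
    show "compact (box \<times> {0..C})" using box by (intro compact_Times) auto
    have "closed {x::nat \<Rightarrow> real. x i = 1}" for i
      by (intro closed_Collect_eq continuous_on_product_coordinates continuous_intros)
    then show "closed (top \<times> (UNIV :: real set))"
      unfolding top_def by (intro closed_Times closed_UN) auto
    have "continuous_on UNIV (\<lambda>p::(nat \<Rightarrow> real) \<times> real. tensor_form k n a (fst p) i)" for i
      unfolding continuous_on_def
      using cont[unfolded continuous_on_def] by (auto intro!: tendsto_tensor_form)
    then show "closed (\<Inter>i<n. {p. snd p * fst p i ^ k \<le> tensor_form k n a (fst p) i})"
      by (intro closed_INT ballI closed_Collect_le continuous_intros cont)
  qed
  have normalise: "\<exists>z. (z, s) \<in> S" if sub: "subinvariant k n a y s" for y s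
  proof -
    define M where "M = Max (y ` {..<n})"
    have yM: "y i \<le> M" if "i < n" for i unfolding M_def using that by simp
    have "M \<in> y ` {..<n}" unfolding M_def using n by (intro Max_in) (auto simp: lessThan_empty_iff)
    then obtain i where i: "i < n" "y i = M" by auto
    have "M > 0" using sub yM by (force simp: subinvariant_def)
    define z where "z = (\<lambda>j. if j < n then inverse M * y j else 0)"
    have form: "tensor_form k n a z j = inverse M ^ k * tensor_form k n a y j" for j
    proof -
      have "tensor_form k n a z j = tensor_form k n a (\<lambda>j. inverse M * y j) j"
        unfolding tensor_form_def
        by (intro sum.cong refl arg_cong2[where f = "(*)"] arg_cong[where f = prod_list] map_cong)
           (auto simp: z_def tensor_indices_def)
      then show ?thesis by (simp add: tensor_form_scale)
    qed
    have z_box: "0 \<le> z j" "z j \<le> 1" for j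
      using sub yM[of j] \<open>M > 0\<close> by (auto simp: z_def subinvariant_def field_simps)
    have z_sub: "s * z j ^ k \<le> tensor_form k n a z j" if "j < n" for j
    proof -
      have "inverse M ^ k * (s * y j ^ k) \<le> inverse M ^ k * tensor_form k n a y j"
        using sub that \<open>M > 0\<close> by (intro mult_left_mono) (auto simp: subinvariant_def)
      then show ?thesis
        using that by (simp add: form) (simp add: z_def power_mult_distrib mult_ac)
    qed
    have zi: "z i = 1" using i \<open>M > 0\<close> by (simp add: z_def)
    have "s \<le> tensor_form k n a z i" using z_sub[of i] i zi by simp
    also have "\<dots> \<le> tensor_form k n a (\<lambda>_. 1) i"
      using a i z_box by (intro tensor_form_mono) auto
    also have "\<dots> \<le> C" using C i by blast
    finally have "(z, s) \<in> S"
      using z_box z_sub zi i(1) sub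
      by (auto simp: S_def box_def top_def subinvariant_def) (simp_all add: z_def)
    then show ?thesis by blast
  qed
  have sub_S: "subinvariant k n a z s" if "(z, s) \<in> S" for z s
  proof -
    have "0 \<le> z i" if "i < n" for i
      using \<open>(z, s) \<in> S\<close> that by (auto simp: S_def box_def dest: spec[of _ i])
    moreover obtain i where "i < n" "z i = 1"
      using \<open>(z, s) \<in> S\<close> by (auto simp: S_def top_def)
    moreover from this have "0 < z i" by simp
    ultimately show ?thesis using that unfolding subinvariant_def by (auto simp: S_def)
  qed
  have "subinvariant k n a (\<lambda>_. 1) 0"
    using a n unfolding subinvariant_def
    by (auto simp: tensor_form_def nonneg_array_def map_replicate_const
        intro!: sum_nonneg exI[of _ 0])
  then have "S \<noteq> {}" using normalise by blast
  then obtain p where p: "p \<in> S" "\<forall>q\<in>S. snd q \<le> snd p"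
    using continuous_attains_sup[OF \<open>compact S\<close> _ continuous_on_snd[OF continuous_on_id]] by blast
  have "subinvariant k n a (fst p) (snd p)" using sub_S p(1) by simp
  moreover have "\<forall>y s. subinvariant k n a y s \<longrightarrow> s \<le> snd p"
    using normalise p(2) by fastforce
  ultimately show ?thesis by blast
qed

text \<open>
  Among the maximal pairs that fail to be eigenpairs, one whose set \<open>K\<close> of strict indices is as large
  as possible yields a contradiction: either \<open>K\<close> is everything and \<open>t\<close> can be raised, or a small
  increase of \<open>x\<close> on \<open>K\<close> produces a larger set of strict indices with the same \<open>t\<close>.  At the
  new index the form increases strictly even if \<open>x\<close> vanishes on \<open>K\<close>, because every factor of the
  relevant monomial increases.
\<close>

lemma maximal_subinvariant_is_eigenpair:
  assumes a: "nonneg_array k n a" and k: "k \<ge> 1" and irr: "irreducible_array k n a"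
    and sub: "subinvariant k n a x t"
    and max: "\<And>y s. subinvariant k n a y s \<Longrightarrow> s \<le> t"
    and i: "i < n"
  shows "tensor_form k n a x i = t * x i ^ k"
proof (rule ccontr)
  assume neq: "tensor_form k n a x i \<noteq> t * x i ^ k"
  define K where "K y = {i. i < n \<and> t * y i ^ k < tensor_form k n a y i}" for y
  have K_sub: "K y \<subseteq> {..<n}" for y by (auto simp: K_def)
  have card_K: "card (K y) < Suc n" for y
    using card_mono[OF finite_lessThan K_sub] by (simp add: less_Suc_eq_le)
  have "K x \<noteq> {}" using neq sub i by (force simp: K_def subinvariant_def)
  then obtain y where y: "subinvariant k n a y t" "K y \<noteq> {}"
    and y_max: "\<And>z. subinvariant k n a z t \<Longrightarrow> K z \<noteq> {} \<Longrightarrow> card (K z) \<le> card (K y)"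
  proof -
    have "\<exists>y. (subinvariant k n a y t \<and> K y \<noteq> {}) \<and>
        (\<forall>z. subinvariant k n a z t \<and> K z \<noteq> {} \<longrightarrow> card (K z) \<le> card (K y))"
      by (rule ex_has_greatest_nat[of _ x _ "Suc n"]) (use sub \<open>K x \<noteq> {}\<close> card_K in auto)
    then show ?thesis using that by blast
  qed
  show False
  proof (cases "K y = {0..<n}")
    case True
    have "\<forall>\<^sub>F e in at_right 0. (t + e) * y i ^ k < tensor_form k n a y i" if "i < n" for i
    proof -
      have "((\<lambda>e. (t + e) * y i ^ k) \<longlongrightarrow> (t + 0) * y i ^ k) (at_right 0)"
        by (intro tendsto_intros)
      moreover have "i \<in> K y" using True that by simp
      then have "(t + 0) * y i ^ k < tensor_form k n a y i" by (simp add: K_def)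
      ultimately show ?thesis by (rule order_tendstoD(2))
    qed
    then have "\<forall>\<^sub>F e in at_right 0. \<forall>i\<in>{..<n}. (t + e) * y i ^ k < tensor_form k n a y i"
      by (intro eventually_ball_finite) auto
    then have "\<forall>\<^sub>F e in at_right 0. (\<forall>i\<in>{..<n}. (t + e) * y i ^ k < tensor_form k n a y i) \<and> (0::real) < e"
      by (intro eventually_conj eventually_at_right_less)
    then obtain e where e: "\<forall>i\<in>{..<n}. (t + e) * y i ^ k < tensor_form k n a y i" "0 < e"
      using eventually_happens'[OF trivial_limit_at_right_real] by blast
    then have "subinvariant k n a y (t + e)"
      using y(1) by (auto simp: subinvariant_def intro: less_imp_le)
    then show False using max[of y "t + e"] e(2) by simp
  next
    case False
    \<comment> \<open>The index l below lies outside K, so its own component does not move, while all indices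
      of the entry linking it to K lie in K.\<close>
    define z where "z e = (\<lambda>j. if j \<in> K y then y j + e else y j)" for e
    have z_lim: "((\<lambda>e. z e j) \<longlongrightarrow> y j) (at_right 0)" for j
    proof -
      have "((\<lambda>e. y j + e) \<longlongrightarrow> y j + 0) (at_right 0)" by (intro tendsto_intros)
      then show ?thesis by (cases "j \<in> K y") (simp_all add: z_def)
    qed
    have "\<forall>\<^sub>F e in at_right 0. 0 < tensor_form k n a (z e) i - t * z e i ^ k" if "i \<in> K y" for i
    proof -
      have "((\<lambda>e. tensor_form k n a (z e) i - t * z e i ^ k) \<longlongrightarrow>
          tensor_form k n a y i - t * y i ^ k) (at_right 0)"
        by (intro tendsto_intros tendsto_tensor_form z_lim)
      moreover have "0 < tensor_form k n a y i - t * y i ^ k" using that by (simp add: K_def)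
      ultimately show ?thesis by (rule order_tendstoD(1))
    qed
    then have "\<forall>\<^sub>F e in at_right 0. \<forall>i\<in>K y. 0 < tensor_form k n a (z e) i - t * z e i ^ k"
      using finite_subset[OF K_sub] by (intro eventually_ball_finite) auto
    then have "\<forall>\<^sub>F e in at_right 0. (\<forall>i\<in>K y. 0 < tensor_form k n a (z e) i - t * z e i ^ k) \<and> (0::real) < e"
      by (intro eventually_conj eventually_at_right_less)
    then obtain e where e: "\<forall>i\<in>K y. 0 < tensor_form k n a (z e) i - t * z e i ^ k" "0 < e"
      using eventually_happens'[OF trivial_limit_at_right_real] by blast
    have y_nonneg: "0 \<le> y j" if "j < n" for j using y(1) that by (simp add: subinvariant_def)
    have y_z: "y j \<le> z e j" for j using e(2) by (simp add: z_def)
    have z_sub: "subinvariant k n a (z e) t"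
      unfolding subinvariant_def
    proof (intro conjI allI impI)
      show "\<exists>j<n. 0 < z e j" using y(1) y_z unfolding subinvariant_def by (meson less_le_trans)
      show "0 \<le> z e j" if "j < n" for j using y_nonneg[OF that] y_z[of j] by linarith
      show "0 \<le> t" using y(1) by (simp add: subinvariant_def)
      show "t * z e j ^ k \<le> tensor_form k n a (z e) j" if "j < n" for j
      proof (cases "j \<in> K y")
        case True
        then show ?thesis using e(1) by force
      next
        case False
        then have "t * z e j ^ k \<le> tensor_form k n a y j"
          using y(1) that by (simp add: z_def subinvariant_def)
        also have "\<dots> \<le> tensor_form k n a (z e) j"
          using a that y_nonneg y_z by (intro tensor_form_mono) auto
        finally show ?thesis .
      qed
    qed
    have "{0..<n} - K y \<noteq> {}" "{0..<n} - K y \<subset> {0..<n}"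
      using False y(2) K_sub[of y] unfolding lessThan_atLeast0 by blast+
    then obtain l ks where l: "l \<in> {0..<n} - K y" "ks \<in> tensor_indices k n"
        "set ks \<inter> ({0..<n} - K y) = {}" "a (l # ks) \<noteq> 0"
      by (rule irreducible_arrayE[OF irr])
    have "t * z e l ^ k = t * y l ^ k" using l(1) by (simp add: z_def)
    also have "\<dots> \<le> tensor_form k n a y l" using y(1) l(1) by (simp add: subinvariant_def)
    also have "\<dots> < tensor_form k n a (z e) l"
    proof (rule tensor_form_strict_mono[OF a _ k y_nonneg y_z l(2,4)])
      show "l < n" using l(1) by simp
      show "y j < z e j" if "j \<in> set ks" for j
        using l(2,3) that e(2) by (auto simp: z_def tensor_indices_def)
    qed
    finally have "l \<in> K (z e)" using l(1) by (simp add: K_def)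
    moreover have "K y \<subseteq> K (z e)" using e(1) K_sub[of y] by (auto simp: K_def)
    ultimately have "K y \<subset> K (z e)" using l(1) by auto
    then have "card (K y) < card (K (z e))"
      using finite_subset[OF K_sub] by (intro psubset_card_mono) auto
    moreover have "K (z e) \<noteq> {}" using \<open>l \<in> K (z e)\<close> by auto
    ultimately show False using y_max[OF z_sub] by simp
  qed
qed

text \<open>
  On the zero set of a maximal solution the eigenvalue equation has right-hand side \<open>0\<close>, whereas an
  entry leading from a proper nonempty zero set into its complement makes the left-hand side positive.
\<close>

lemma perron_pair_exists:
  assumes a: "nonneg_array k n a" and k: "k \<ge> 1" and n: "n \<ge> 1" and irr: "irreducible_array k n a"
  obtains r p where "0 \<le> r" "\<And>i. i < n \<Longrightarrow> 0 < p i"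
    "\<And>i. i < n \<Longrightarrow> tensor_form k n a p i = r * p i ^ k"
proof -
  obtain p r where sub: "subinvariant k n a p r"
    and max: "\<And>y s. subinvariant k n a y s \<Longrightarrow> s \<le> r"
    using maximal_subinvariant_exists[OF a n] by blast
  have eig: "tensor_form k n a p i = r * p i ^ k" if "i < n" for i
    using maximal_subinvariant_is_eigenpair[OF a k irr sub max that] .
  have nonneg: "0 \<le> p i" if "i < n" for i using sub that by (simp add: subinvariant_def)
  define I where "I = {i. i < n \<and> p i = 0}"
  have "I = {}"
  proof (rule ccontr)
    assume "I \<noteq> {}"
    moreover have "I \<subset> {0..<n}"
    proof
      obtain h where "h < n" "0 < p h" using sub unfolding subinvariant_def by blast
      then have "h \<in> {0..<n}" "h \<notin> I" by (auto simp: I_def)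
      then show "I \<noteq> {0..<n}" by blast
    qed (auto simp: I_def)
    ultimately obtain i js where ij: "i \<in> I" "js \<in> tensor_indices k n" "set js \<inter> I = {}" "a (i # js) \<noteq> 0"
      by (rule irreducible_arrayE[OF irr])
    have "prod_list (map (\<lambda>_. 0::real) ks) = 0" if "ks \<in> tensor_indices k n" for ks
      using that k by (cases ks) (auto simp: tensor_indices_def)
    then have "0 = tensor_form k n a (\<lambda>_. 0) i" by (simp add: tensor_form_def)
    also have "\<dots> < tensor_form k n a p i"
    proof (rule tensor_form_strict_mono[OF a _ k _ _ ij(2,4)])
      show "0 < p j" if "j \<in> set js" for j
        using ij(2,3) that nonneg[of j] by (force simp: I_def tensor_indices_def less_le)
    qed (use ij nonneg in \<open>auto simp: I_def\<close>)
    also have "\<dots> = 0" using eig[of i] ij(1) k by (simp add: I_def)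
    finally show False by simp
  qed
  then have "0 < p i" if "i < n" for i using nonneg[OF that] that by (auto simp: I_def less_le)
  moreover have "0 \<le> r" using sub by (simp add: subinvariant_def)
  ultimately show ?thesis using that eig by blast
qed


section \<open>Passing between real arrays and complex tensors\<close>

lemma Re_of_nonneg_Reals: "z \<in> \<real>\<^sub>\<ge>\<^sub>0 \<Longrightarrow> complex_of_real (Re z) = z"
  by (simp add: complex_eq_iff complex_nonneg_Reals_iff)

lemma irreducible_array_if_irreducible_tensor:
  assumes irr: "irreducible_tensor (Suc k) n A"
  shows "irreducible_array k n A"
  unfolding irreducible_array_def
proof (intro allI impI)
  fix I assume "I \<noteq> {} \<and> I \<subset> {0..<n}"
  then have "\<not> (\<forall>i\<in>I. \<forall>js\<in>tensor_indices k n. set js \<inter> I = {} \<longrightarrow> A (i # js) = 0)"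
    using irr[unfolded reducible_tensor_def not_ex, THEN spec[of _ I]] by simp
  then show "\<exists>i\<in>I. \<exists>js\<in>tensor_indices k n. set js \<inter> I = {} \<and> A (i # js) \<noteq> 0"
    by simp
qed

lemma nonneg_array_Re:
  assumes "nonneg_tensor (Suc k) n A"
  shows "nonneg_array k n (\<lambda>js. Re (A js))"
  unfolding nonneg_array_def
proof (intro allI impI ballI)
  fix i js assume "i < n" "js \<in> tensor_indices k n"
  then have "A (i # js) \<in> \<real>\<^sub>\<ge>\<^sub>0"
    using assms by (simp add: nonneg_tensor_def Cons_in_tensor_indices)
  then show "0 \<le> Re (A (i # js))" by (simp add: complex_nonneg_Reals_iff)
qed

lemma irreducible_array_Re:
  assumes "nonneg_tensor (Suc k) n A" "irreducible_array k n A"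
  shows "irreducible_array k n (\<lambda>js. Re (A js))"
  unfolding irreducible_array_def
proof (intro allI impI)
  fix I assume I: "I \<noteq> {} \<and> I \<subset> {0..<n}"
  obtain i js where ij: "i \<in> I" "js \<in> tensor_indices k n" "set js \<inter> I = {}" "A (i # js) \<noteq> 0"
    using I by (auto intro: irreducible_arrayE[OF assms(2)])
  have "i # js \<in> tensor_indices (Suc k) n" using ij I by (auto simp: Cons_in_tensor_indices)
  then have "complex_of_real (Re (A (i # js))) = A (i # js)"
    using assms(1) by (intro Re_of_nonneg_Reals) (simp add: nonneg_tensor_def)
  then have "Re (A (i # js)) \<noteq> 0" using ij(4) by auto
  then show "\<exists>i\<in>I. \<exists>js\<in>tensor_indices k n. set js \<inter> I = {} \<and> Re (A (i # js)) \<noteq> 0"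
    using ij by blast
qed

lemma tensor_form_of_real:
  assumes "nonneg_tensor (Suc k) n A" "i < n"
  shows "tensor_form k n A (\<lambda>j. complex_of_real (x j)) i =
    complex_of_real (tensor_form k n (\<lambda>js. Re (A js)) x i)"
proof -
  have "prod_list (map (\<lambda>j. complex_of_real (x j)) js) = complex_of_real (prod_list (map x js))" for js
    by (induction js) auto
  moreover have "complex_of_real (Re (A (i # js))) = A (i # js)" if "js \<in> tensor_indices k n" for js
    using assms that by (intro Re_of_nonneg_Reals) (simp add: nonneg_tensor_def Cons_in_tensor_indices)
  ultimately show ?thesis by (simp add: tensor_form_def)
qed

lemma tensor_eigenvector_iff:
  "tensor_eigenvector (Suc k) n A l x \<longleftrightarrow> x \<in> carrier_vec n \<and> (\<exists>i<n. x $ i \<noteq> 0) \<and>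
     (\<forall>i<n. tensor_form k n A (vec_index x) i = l * (x $ i) ^ k)"
proof (cases "x \<in> carrier_vec n")
  case True
  then have dim: "dim_vec x = n" by simp
  have "x \<noteq> 0\<^sub>v n \<longleftrightarrow> (\<exists>i<n. x $ i \<noteq> 0)"
    unfolding vec_eq_iff using dim by simp
  moreover have "tensor_apply (Suc k) n A x = l \<cdot>\<^sub>v vec_hpower x k \<longleftrightarrow>
      (\<forall>i<n. tensor_form k n A (vec_index x) i = l * (x $ i) ^ k)"
    unfolding vec_eq_iff using dim by (simp add: tensor_apply_def vec_hpower_def tensor_form_def)
  ultimately show ?thesis using True unfolding tensor_eigenvector_def diff_Suc_1 by blast
next
  case False
  then show ?thesis unfolding tensor_eigenvector_def by blast
qed

lemma cmod_prod_list_map: "cmod (prod_list (map x js)) = prod_list (map (\<lambda>j. cmod (x j)) js)"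
  by (induction js) (auto simp: norm_mult)

lemma prod_list_map_times:
  fixes x y :: "nat \<Rightarrow> 'a::comm_semiring_1"
  shows "prod_list (map (\<lambda>j. x j * y j) js) = prod_list (map x js) * prod_list (map y js)"
  by (induction js) (auto simp: algebra_simps)

lemma prod_list_map_le_power:
  fixes x :: "nat \<Rightarrow> real"
  assumes "\<And>j. j \<in> set js \<Longrightarrow> 0 \<le> x j \<and> x j \<le> c"
  shows "prod_list (map x js) \<le> c ^ length js"
proof -
  have "prod_list (map x js) \<le> prod_list (map (\<lambda>_. c) js)"
    using assms by (intro prod_list_map_mono) auto
  then show ?thesis by (simp add: map_replicate_const)
qed

section \<open>Rigidity from combinatorial symmetry\<close>

text \<open>
  An entry leading from outside the level set of \<open>f i0\<close> into it turns, by symmetry, into an entry that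
  starts in the level set and has exactly one index outside.  So the equation is assumed on the level
  set alone; for eigenvectors it is known just at indices of maximal ratio.
\<close>

lemma constant_if_balanced:
  fixes f :: "nat \<Rightarrow> complex" and A :: tensor
  assumes k: "k \<ge> 1" and sym: "combinatorially_symmetric (Suc k) n A" and irr: "irreducible_array k n A"
    and i0: "i0 < n" "f i0 \<noteq> 0"
    and balanced: "\<And>i js. i < n \<Longrightarrow> js \<in> tensor_indices k n \<Longrightarrow> A (i # js) \<noteq> 0 \<Longrightarrow> f i = f i0 \<Longrightarrow>
       prod_list (map f js) = f i ^ k"
    and i: "i < n"
  shows "f i = f i0"
proof (rule ccontr)
  assume neq: "f i \<noteq> f i0"
  define I where "I = {i. i < n \<and> f i \<noteq> f i0}"
  have "I \<noteq> {}" using neq i by (auto simp: I_def)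
  moreover have "I \<subset> {0..<n}"
  proof
    show "I \<subseteq> {0..<n}" by (auto simp: I_def)
    have "i0 \<in> {0..<n}" "i0 \<notin> I" using i0 by (simp_all add: I_def)
    then show "I \<noteq> {0..<n}" by blast
  qed
  ultimately obtain l js where l: "l \<in> I" "js \<in> tensor_indices k n" "set js \<inter> I = {}" "A (l # js) \<noteq> 0"
    by (rule irreducible_arrayE[OF irr])
  obtain j ks where js: "js = j # ks" using l(2) k by (cases js) (auto simp: tensor_indices_def)
  have f_js: "f h = f i0" if "h \<in> set js" for h
  proof -
    have "h < n" "h \<notin> I" using l(2,3) that by (auto simp: tensor_indices_def)
    then show ?thesis by (simp add: I_def)
  qed
  have ind: "l # j # ks \<in> tensor_indices (Suc k) n"
    using l(1,2) by (simp add: Cons_in_tensor_indices I_def js)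
  \<comment> \<open>Exchanging the first two indices moves the exceptional index l out of the first place.\<close>
  define \<pi> where "\<pi> = transpose (0::nat) 1"
  have perm: "\<pi> permutes {..<Suc k}" unfolding \<pi>_def using k by (intro permutes_swap_id) auto
  have "permute_list \<pi> (l # j # ks) = j # l # ks"
  proof (rule nth_equalityI)
    fix h assume "h < length (permute_list \<pi> (l # j # ks))"
    moreover have "length (l # j # ks) = Suc k" using ind by (simp add: tensor_indices_def)
    ultimately have "permute_list \<pi> (l # j # ks) ! h = (l # j # ks) ! \<pi> h"
      using perm by (intro permute_list_nth) simp_all
    also have "\<dots> = (j # l # ks) ! h"
    proof -
      consider "h = 0" | "h = 1" | i where "h = Suc (Suc i)" by (metis One_nat_def not0_implies_Suc)
      then show ?thesis by cases (simp_all add: \<pi>_def transpose_def)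
    qed
    finally show "permute_list \<pi> (l # j # ks) ! h = (j # l # ks) ! h" .
  qed simp
  then have "A (j # l # ks) \<noteq> 0"
    using sym[unfolded combinatorially_symmetric_def, rule_format, OF ind perm] l(4)
    by (simp add: js)
  moreover have "j < n" "l # ks \<in> tensor_indices k n"
    using ind by (auto simp: tensor_indices_def)
  ultimately have "prod_list (map f (l # ks)) = f j ^ k"
    using balanced[of j "l # ks"] f_js[of j] by (simp add: js)
  moreover have "map f ks = replicate (k - 1) (f i0)"
    using f_js l(2) by (intro replicate_eqI) (auto simp: js tensor_indices_def)
  ultimately have "f l * f i0 ^ (k - 1) = f i0 ^ k"
    using f_js by (simp add: js)
  also have "\<dots> = f i0 * f i0 ^ (k - 1)" using k by (cases k) auto
  finally have "f l = f i0" using i0(2) by simp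
  then show False using l(1) by (simp add: I_def)
qed

text \<open>
  At a nonzero entry, invariance under the scaling by \<open>D\<close> cancels to the equation of
  \<open>constant_if_balanced\<close> for the diagonal of \<open>D\<close>, and the value at index \<open>0\<close> is normalised to \<open>1\<close>.
\<close>

lemma stabilizer_eq_one:
  assumes k: "k \<ge> 1" and n: "n \<ge> 1"
    and sym: "combinatorially_symmetric (Suc k) n A" and irr: "irreducible_array k n A"
  shows "stabilizer (Suc k) n A = {1\<^sub>m n}"
proof (intro equalityI subsetI)
  fix D assume "D \<in> stabilizer (Suc k) n A"
  then have D: "D \<in> carrier_mat n n" "diagonal_mat D" "D $$ (0, 0) = 1"
    and inv: "\<And>js. js \<in> tensor_indices (Suc k) n \<Longrightarrow> A js = diagonal_scaling (Suc k) D A js"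
    by (auto simp: stabilizer_def)
  have "D $$ (i, i) = 1" if "i < n" for i
  proof -
    have "prod_list (map (\<lambda>j. D $$ (j, j)) js) = D $$ (i, i) ^ k"
      if "i < n" "js \<in> tensor_indices k n" "A (i # js) \<noteq> 0" "D $$ (i, i) = D $$ (0, 0)" for i js
      using inv[of "i # js"] that D(3) by (auto simp: Cons_in_tensor_indices diagonal_scaling_def)
    then show ?thesis
      using constant_if_balanced[OF k sym irr, where f = "\<lambda>j. D $$ (j, j)" and ?i0.0 = 0 and i = i]
        D(3) n that by auto
  qed
  then show "D \<in> {1\<^sub>m n}" using D by (auto simp: diagonal_mat_def intro!: eq_matI)
next
  fix D :: "complex mat" assume "D \<in> {1\<^sub>m n}"
  then have D: "D = 1\<^sub>m n" by simp
  have "invertible_mat (1\<^sub>m n :: complex mat)"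
    unfolding invertible_mat_def inverts_mat_def by (auto intro!: exI[of _ "1\<^sub>m n"])
  moreover have "A js = diagonal_scaling (Suc k) (1\<^sub>m n) A js" if "js \<in> tensor_indices (Suc k) n" for js
  proof -
    obtain i ks where js: "js = i # ks"
      using \<open>js \<in> tensor_indices (Suc k) n\<close> by (cases js) (auto simp: tensor_indices_def)
    have "map (\<lambda>j. 1\<^sub>m n $$ (j, j) :: complex) ks = map (\<lambda>_. 1) ks"
      using that by (auto simp: js tensor_indices_def)
    moreover have "i < n" using that by (simp add: js Cons_in_tensor_indices)
    ultimately show ?thesis by (simp add: diagonal_scaling_def js map_replicate_const)
  qed
  ultimately show "D \<in> stabilizer (Suc k) n A"
    using n by (auto simp: D stabilizer_def diagonal_mat_def)
qed

section \<open>Eigenvalues and eigenvectors compared with the Perron pair\<close>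

lemma cmod_tensor_form_le:
  assumes A: "nonneg_tensor (Suc k) n A" and i: "i < n"
  shows "cmod (tensor_form k n A x i) \<le> tensor_form k n (\<lambda>js. Re (A js)) (\<lambda>j. cmod (x j)) i"
  unfolding tensor_form_def
proof (rule order_trans[OF norm_sum], rule sum_mono)
  fix js assume "js \<in> tensor_indices k n"
  then have "A (i # js) \<in> \<real>\<^sub>\<ge>\<^sub>0" using A i by (simp add: nonneg_tensor_def Cons_in_tensor_indices)
  then have "cmod (A (i # js)) = Re (A (i # js))"
    by (simp add: complex_nonneg_Reals_iff cmod_eq_Re)
  then show "cmod (A (i # js) * prod_list (map x js)) \<le> Re (A (i # js)) * prod_list (map (\<lambda>j. cmod (x j)) js)"
    by (simp add: norm_mult cmod_prod_list_map)
qed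

lemma max_ratio_exists:
  fixes p :: "nat \<Rightarrow> real"
  assumes p: "\<And>i. i < n \<Longrightarrow> 0 < p i" and x: "\<exists>i<n. x i \<noteq> (0::complex)"
  obtains c i where "0 < c" "i < n" "cmod (x i) = c * p i" "\<And>j. j < n \<Longrightarrow> cmod (x j) \<le> c * p j"
proof -
  define q where "q j = cmod (x j) / p j" for j
  obtain h where h: "h < n" "x h \<noteq> 0" using x by blast
  have "Max (q ` {..<n}) \<in> q ` {..<n}" using h by (intro Max_in) auto
  then obtain i where i: "i < n" "q i = Max (q ` {..<n})" by auto
  have q_le: "q j \<le> q i" if "j < n" for j using that by (simp add: i)
  show ?thesis
  proof (rule that)
    have "0 < q h" using h p by (simp add: q_def)
    then show "0 < q i" using q_le[OF h(1)] by simp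
    show "i < n" by fact
    show "cmod (x i) = q i * p i" using p[OF i(1)] by (simp add: q_def)
    show "cmod (x j) \<le> q i * p j" if "j < n" for j
      using q_le[OF that] p[OF that] by (simp add: q_def[of j] pos_divide_le_eq)
  qed
qed

text \<open>
  With \<open>c\<close> the largest ratio of \<open>\<bar>v\<bar>\<close> to \<open>p\<close>, attained at \<open>i\<close>, the vector \<open>\<bar>v\<bar>\<close> is dominated by
  \<open>c p\<close> with equality at \<open>i\<close>; monotonicity of the form compares the two eigenvalue equations there.
\<close>

lemma eigenvalue_le_perron_value:
  assumes A: "nonneg_tensor (Suc k) n A"
    and p: "\<And>i. i < n \<Longrightarrow> 0 < p i"
    and eig: "\<And>i. i < n \<Longrightarrow> tensor_form k n (\<lambda>js. Re (A js)) p i = r * p i ^ k"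
    and l: "tensor_eigenvalue (Suc k) n A l"
  shows "cmod l \<le> r"
proof -
  obtain v where v: "tensor_eigenvector (Suc k) n A l v" using l by (auto simp: tensor_eigenvalue_def)
  then have "\<exists>i<n. v $ i \<noteq> 0" by (simp add: tensor_eigenvector_iff)
  from max_ratio_exists[where p = p, OF p this] obtain c i where c: "0 < c" "i < n" "cmod (v $ i) = c * p i"
    "\<And>j. j < n \<Longrightarrow> cmod (v $ j) \<le> c * p j" by blast
  have "cmod l * (c * p i) ^ k = cmod (l * (v $ i) ^ k)" by (simp add: norm_mult norm_power c(3))
  also have "\<dots> = cmod (tensor_form k n A (vec_index v) i)" using v c(2) by (simp add: tensor_eigenvector_iff)
  also have "\<dots> \<le> tensor_form k n (\<lambda>js. Re (A js)) (\<lambda>j. cmod (v $ j)) i"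
    by (rule cmod_tensor_form_le[OF A c(2)])
  also have "\<dots> \<le> tensor_form k n (\<lambda>js. Re (A js)) (\<lambda>j. c * p j) i"
    using c(4) by (intro tensor_form_mono[OF nonneg_array_Re[OF A] c(2)]) auto
  also have "\<dots> = r * (c * p i) ^ k" using eig c(2) by (simp add: tensor_form_scale power_mult_distrib)
  finally show ?thesis using c(1) p[OF c(2)] by (simp add: mult_le_cancel_right)
qed

text \<open>
  Put \<open>f = v / p\<close>.  At an index \<open>i\<close> with \<open>\<bar>f i\<bar>\<close> maximal, dividing the eigenvalue equation of \<open>v\<close> by
  \<open>(f i)\<^sup>k\<close> and comparing with that of \<open>p\<close> writes a sum of nonnegative weights as the same sum with each
  weight multiplied by a complex number of modulus at most \<open>1\<close>.  So each of these numbers with a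
  positive weight is \<open>1\<close>, which is the equation that makes \<open>f\<close> constant.
\<close>

lemma perron_eigenvector_unique:
  assumes k: "k \<ge> 1" and A: "nonneg_tensor (Suc k) n A"
    and sym: "combinatorially_symmetric (Suc k) n A" and irr: "irreducible_array k n A"
    and p: "\<And>i. i < n \<Longrightarrow> 0 < p i"
    and eig: "\<And>i. i < n \<Longrightarrow> tensor_form k n (\<lambda>js. Re (A js)) p i = r * p i ^ k"
    and v: "tensor_eigenvector (Suc k) n A (complex_of_real r) v"
  obtains c where "c \<noteq> 0" "\<And>i. i < n \<Longrightarrow> v $ i = c * complex_of_real (p i)"
proof -
  have "\<exists>i<n. v $ i \<noteq> 0" using v by (simp add: tensor_eigenvector_iff)
  from max_ratio_exists[where p = p, OF p this] obtain c i0 where c: "0 < c" "i0 < n" "cmod (v $ i0) = c * p i0"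
    "\<And>j. j < n \<Longrightarrow> cmod (v $ j) \<le> c * p j" by blast
  define f where "f j = v $ j / complex_of_real (p j)" for j
  have v_f: "v $ j = f j * complex_of_real (p j)" if "j < n" for j using p[OF that] by (simp add: f_def)
  have f_le: "cmod (f j) \<le> c" if "j < n" for j
    using c(4)[OF that] p[OF that] by (simp add: f_def norm_divide pos_divide_le_eq)
  have f_i0: "cmod (f i0) = c" using c(2,3) p[of i0] by (simp add: f_def norm_divide)
  have balanced: "prod_list (map f js) = f i ^ k"
    if i: "i < n" and js: "js \<in> tensor_indices k n" "A (i # js) \<noteq> 0" and fi: "f i = f i0" for i js
  proof -
    have norm_fi: "cmod (f i) = c" using fi f_i0 by simp
    then have fi0: "f i \<noteq> 0" using c(1) by auto
    \<comment> \<open>The weights w sum to the form of p at i, and the products of values of g are the complex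
      factors that distinguish v from a multiple of p.\<close>
    define g where "g j = f j / f i" for j
    define w where "w ks = Re (A (i # ks)) * prod_list (map p ks)" for ks
    have w: "0 \<le> w ks" if "ks \<in> tensor_indices k n" for ks
      unfolding w_def
    proof (intro mult_nonneg_nonneg prod_list_map_nonneg)
      show "0 \<le> Re (A (i # ks))"
        using nonneg_array_Re[OF A] i that by (simp add: nonneg_array_def)
      show "0 \<le> p j" if "j \<in> set ks" for j
        using p[of j] that \<open>ks \<in> tensor_indices k n\<close> by (auto simp: tensor_indices_def)
    qed
    have g_le: "cmod (prod_list (map g ks)) \<le> 1" if "ks \<in> tensor_indices k n" for ks
    proof -
      have "cmod (prod_list (map g ks)) \<le> 1 ^ length ks" unfolding cmod_prod_list_map
        using that f_le c(1) by (intro prod_list_map_le_power)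
         (auto simp: g_def norm_divide norm_fi tensor_indices_def)
      then show ?thesis by simp
    qed
    have summand: "A (i # ks) * prod_list (map (vec_index v) ks) =
        f i ^ k * (complex_of_real (w ks) * prod_list (map g ks))" if ks: "ks \<in> tensor_indices k n" for ks
    proof -
      have "map (vec_index v) ks = map (\<lambda>j. f i * (complex_of_real (p j) * g j)) ks"
        using ks v_f fi0 by (auto simp: tensor_indices_def g_def)
      then have "prod_list (map (vec_index v) ks) =
          prod_list (map (\<lambda>j. f i * (complex_of_real (p j) * g j)) ks)"
        by (rule arg_cong)
      also have "\<dots> = f i ^ k * (prod_list (map (\<lambda>j. complex_of_real (p j)) ks) * prod_list (map g ks))"
        using ks by (simp add: prod_list_map_scale prod_list_map_times tensor_indices_def)
      also have "prod_list (map (\<lambda>j. complex_of_real (p j)) ks) = complex_of_real (prod_list (map p ks))"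
        by (induction ks) auto
      finally have "prod_list (map (vec_index v) ks) =
          f i ^ k * (complex_of_real (prod_list (map p ks)) * prod_list (map g ks))" .
      moreover have "complex_of_real (Re (A (i # ks))) = A (i # ks)"
        using A i ks by (intro Re_of_nonneg_Reals) (simp add: nonneg_tensor_def Cons_in_tensor_indices)
      ultimately show ?thesis by (simp add: w_def mult_ac)
    qed
    have "f i ^ k * (\<Sum>ks\<in>tensor_indices k n. complex_of_real (w ks) * prod_list (map g ks)) =
        tensor_form k n A (vec_index v) i"
      unfolding tensor_form_def sum_distrib_left by (intro sum.cong refl) (simp add: summand)
    also have "\<dots> = complex_of_real r * (v $ i) ^ k" using v i by (simp add: tensor_eigenvector_iff)
    also have "\<dots> = f i ^ k * complex_of_real (tensor_form k n (\<lambda>js. Re (A js)) p i)"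
      using eig[OF i] v_f[OF i] by (simp add: power_mult_distrib)
    also have "tensor_form k n (\<lambda>js. Re (A js)) p i = (\<Sum>ks\<in>tensor_indices k n. w ks)"
      by (simp add: tensor_form_def w_def)
    finally have eq: "(\<Sum>ks\<in>tensor_indices k n. complex_of_real (w ks) * prod_list (map g ks)) =
        complex_of_real (\<Sum>ks\<in>tensor_indices k n. w ks)"
      using fi0 by simp
    have "(\<Sum>ks\<in>tensor_indices k n. w ks * (1 - Re (prod_list (map g ks)))) =
       (\<Sum>ks\<in>tensor_indices k n. w ks) - Re (\<Sum>ks\<in>tensor_indices k n. complex_of_real (w ks) * prod_list (map g ks))"
      by (simp add: right_diff_distrib sum_subtractf)
    also have "\<dots> = 0" by (simp add: eq)
    finally have "(\<Sum>ks\<in>tensor_indices k n. w ks * (1 - Re (prod_list (map g ks)))) = 0" .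
    then have "w js * (1 - Re (prod_list (map g js))) = 0"
    proof (subst (asm) sum_nonneg_eq_0_iff[OF finite_tensor_indices])
      show "0 \<le> w ks * (1 - Re (prod_list (map g ks)))" if "ks \<in> tensor_indices k n" for ks
        using w[OF that] g_le[OF that] complex_Re_le_cmod[of "prod_list (map g ks)"]
        by (intro mult_nonneg_nonneg) auto
    qed (use js in auto)
    moreover have "w js \<noteq> 0"
    proof -
      have "complex_of_real (Re (A (i # js))) = A (i # js)"
        using A i js by (intro Re_of_nonneg_Reals) (simp add: nonneg_tensor_def Cons_in_tensor_indices)
      then have "Re (A (i # js)) \<noteq> 0" using js(2) by auto
      moreover have "0 < prod_list (map p js)"
        using js(1) p by (intro prod_list_map_pos) (auto simp: tensor_indices_def)
      ultimately show ?thesis by (simp add: w_def)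
    qed
    ultimately have Re1: "Re (prod_list (map g js)) = 1" by simp
    have "(Re (prod_list (map g js)))\<^sup>2 + (Im (prod_list (map g js)))\<^sup>2 \<le> 1"
      using g_le[OF js(1)] by (simp add: cmod_power2[symmetric] power_le_one)
    then have "prod_list (map g js) = 1" using Re1 by (simp add: complex_eq_iff)
    moreover have "prod_list (map f js) = prod_list (map (\<lambda>j. f i * g j) js)"
      using fi0 by (simp add: g_def)
    ultimately show ?thesis using js(1) by (simp add: prod_list_map_scale tensor_indices_def)
  qed
  have "f i = f i0" if "i < n" for i
  proof (rule constant_if_balanced[OF k sym irr c(2) _ balanced that])
    show "f i0 \<noteq> 0" using f_i0 c(1) by auto
  qed
  then have "v $ i = f i0 * complex_of_real (p i)" if "i < n" for i using that v_f by simp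
  moreover have "f i0 \<noteq> 0" using f_i0 c(1) by auto
  ultimately show ?thesis using that by blast
qed

theorem corollary4p8:
  fixes m n :: nat and A :: tensor
  assumes "m \<ge> 2" and "n \<ge> 1"
    and "nonneg_tensor m n A"
    and "combinatorially_symmetric m n A"
    and "irreducible_tensor m n A"
  shows "(\<exists>p. perron_vector m n A p \<and>
            (\<forall>x. tensor_eigenvector m n A (complex_of_real (tensor_spectral_radius m n A)) x
                  \<longleftrightarrow> (\<exists>c. c \<noteq> 0 \<and> x = c \<cdot>\<^sub>v p)))
         \<and> stabilizing_index m n A = 1"
proof -
  obtain k where m: "m = Suc k" and k: "k \<ge> 1" using assms(1) by (cases m) auto
  note A = assms(3)[unfolded m] and sym = assms(4)[unfolded m]
  have irr: "irreducible_array k n A" using assms(5) by (intro irreducible_array_if_irreducible_tensor) (simp add: m)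
  obtain r p where r: "0 \<le> r" and p: "\<And>i. i < n \<Longrightarrow> 0 < p i"
    and eig: "\<And>i. i < n \<Longrightarrow> tensor_form k n (\<lambda>js. Re (A js)) p i = r * p i ^ k"
    using perron_pair_exists[OF nonneg_array_Re[OF A] k assms(2) irreducible_array_Re[OF A irr]] by blast
  define P where "P = vec n (\<lambda>i. complex_of_real (p i))"
  have eigenvector: "tensor_eigenvector m n A (complex_of_real r) (c \<cdot>\<^sub>v P)" if "c \<noteq> 0" for c
  proof -
    have "tensor_form k n A (vec_index (c \<cdot>\<^sub>v P)) i = complex_of_real r * ((c \<cdot>\<^sub>v P) $ i) ^ k"
      if i: "i < n" for i
    proof -
      have "tensor_form k n A (vec_index (c \<cdot>\<^sub>v P)) i = tensor_form k n A (\<lambda>j. c * complex_of_real (p j)) i"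
        unfolding tensor_form_def
        by (intro sum.cong refl arg_cong2[where f = "(*)"] arg_cong[where f = prod_list] map_cong)
           (auto simp: P_def tensor_indices_def)
      also have "\<dots> = complex_of_real r * (c * complex_of_real (p i)) ^ k"
        by (simp add: tensor_form_scale tensor_form_of_real[OF A i] eig i power_mult_distrib)
      finally show ?thesis using i by (simp add: P_def)
    qed
    moreover have "0 < n" using assms(2) by simp
    moreover from this have "(c \<cdot>\<^sub>v P) $ 0 \<noteq> 0"
      using p[of 0] \<open>c \<noteq> 0\<close> by (simp add: P_def)
    moreover have "c \<cdot>\<^sub>v P \<in> carrier_vec n" by (simp add: P_def)
    ultimately show ?thesis unfolding m tensor_eigenvector_iff by blast
  qed
  have radius: "tensor_spectral_radius m n A = r"
    unfolding tensor_spectral_radius_def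
  proof (rule Greatest_equality)
    show "\<exists>l. tensor_eigenvalue m n A l \<and> r = cmod l"
    proof (intro exI conjI)
      show "tensor_eigenvalue m n A (complex_of_real r)"
        unfolding tensor_eigenvalue_def using eigenvector[OF one_neq_zero] by (rule exI)
      show "r = cmod (complex_of_real r)" using r by simp
    qed
    show "s \<le> r" if s: "\<exists>l. tensor_eigenvalue m n A l \<and> s = cmod l" for s
    proof -
      obtain l where "tensor_eigenvalue (Suc k) n A l" "s = cmod l"
        using s unfolding m by blast
      then show ?thesis using eigenvalue_le_perron_value[OF A p eig] by simp
    qed
  qed
  have "perron_vector m n A P"
  proof -
    have "1 \<cdot>\<^sub>v P = P" by (simp add: P_def vec_eq_iff)
    moreover have "\<forall>i<n. P $ i \<in> \<real> \<and> Re (P $ i) > 0" using p by (simp add: P_def)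
    ultimately show ?thesis
      unfolding perron_vector_def radius using eigenvector[of 1] by simp
  qed
  moreover have "tensor_eigenvector m n A (complex_of_real r) x \<longleftrightarrow> (\<exists>c. c \<noteq> 0 \<and> x = c \<cdot>\<^sub>v P)" for x
  proof
    assume x: "tensor_eigenvector m n A (complex_of_real r) x"
    obtain c where "c \<noteq> 0" "\<And>i. i < n \<Longrightarrow> x $ i = c * complex_of_real (p i)"
      using perron_eigenvector_unique[OF k A sym irr p eig x[unfolded m]] by blast
    moreover have "dim_vec x = n" using x by (simp add: tensor_eigenvector_def)
    ultimately have "x = c \<cdot>\<^sub>v P" by (simp add: P_def vec_eq_iff)
    then show "\<exists>c. c \<noteq> 0 \<and> x = c \<cdot>\<^sub>v P" using \<open>c \<noteq> 0\<close> by blast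
  next
    assume "\<exists>c. c \<noteq> 0 \<and> x = c \<cdot>\<^sub>v P"
    then show "tensor_eigenvector m n A (complex_of_real r) x" using eigenvector by blast
  qed
  moreover have "stabilizing_index m n A = 1"
    using stabilizer_eq_one[OF k assms(2) sym irr] by (simp add: stabilizing_index_def m)
  ultimately show ?thesis unfolding radius by (intro conjI exI[of _ P] allI)
qed

end
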